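(* Let $v$ be a positive integer and let $(Q,\mathcal{B})$ be a uniform nested SQS$(v)$ in which all $\binom{v}{2}$ pairs of $Q$ are ND-pairs. Then $v \equiv 2 \pmod 6$ and the multiplicity of each pair is $\frac{v-2}{6}$.
   Context: A Steiner quadruple system SQS$(v)$ is a pair $(Q,\mathcal{B})$ where $Q$ is a set of $v$ points and $\mathcal{B}$ is a collection of 4-subsets of $Q$ (blocks) such that every 3-subset of $Q$ is contained in exactly one block. (An SQS$(v)$ exists if and only if $v\ge 4$ and $v\equiv 2$ or $4 \pmod 6$.) A nested SQS$(v)$ is an SQS$(v)$ together with a partition of each block into two 2-subsets (pairs). A pair of points is an ND-pair if it is one of the two pairs in the partition of at least one block; the multiplicity of a pair is the number of blocks whose partition contains that pair. A nested SQS is uniform if all its ND-pairs have the same multiplicity. *)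

theory Defs
  imports Complex_Main "HOL-Library.Ramsey" "HOL-Library.Disjoint_Sets" "HOL-Number_Theory.Cong"
begin

text \<open>
  The bound \<open>4 \<le> v\<close> is part of the usual convention, under which a system exists iff
  \<open>4 \<le> v\<close> and \<open>v\<close> is 2 or 4 modulo 6. Among finite systems it excludes only the blockless systems on at most
  two points, where the condition on 3-subsets is vacuous. Together with \<open>card Q = v\<close> it
  makes \<open>Q\<close> finite.
\<close>

definition SQS :: "nat \<Rightarrow> 'a set \<Rightarrow> 'a set set \<Rightarrow> bool" where
  "SQS v Q \<B> \<longleftrightarrow> 4 \<le> v \<and> card Q = v \<and> \<B> \<subseteq> nsets Q 4 \<and>
     (\<forall>T \<in> nsets Q 3. \<exists>!B. B \<in> \<B> \<and> T \<subseteq> B)"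

text \<open>
  A nesting is given by a function \<open>N\<close> sending each block to its partition into two pairs;
  the values of \<open>N\<close> outside the block set are irrelevant.
\<close>

definition nested_SQS :: "nat \<Rightarrow> 'a set \<Rightarrow> 'a set set \<Rightarrow> ('a set \<Rightarrow> 'a set set) \<Rightarrow> bool" where
  "nested_SQS v Q \<B> N \<longleftrightarrow> SQS v Q \<B> \<and>
     (\<forall>B \<in> \<B>. partition_on B (N B) \<and> card (N B) = 2 \<and> N B \<subseteq> nsets B 2)"

definition ND_pair :: "'a set set \<Rightarrow> ('a set \<Rightarrow> 'a set set) \<Rightarrow> 'a set \<Rightarrow> bool" where
  "ND_pair \<B> N P \<longleftrightarrow> (\<exists>B \<in> \<B>. P \<in> N B)"

definition pair_multiplicity :: "'a set set \<Rightarrow> ('a set \<Rightarrow> 'a set set) \<Rightarrow> 'a set \<Rightarrow> nat" where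
  "pair_multiplicity \<B> N P = card {B \<in> \<B>. P \<in> N B}"

definition uniform_nested_SQS ::
    "nat \<Rightarrow> 'a set \<Rightarrow> 'a set set \<Rightarrow> ('a set \<Rightarrow> 'a set set) \<Rightarrow> bool" where
  "uniform_nested_SQS v Q \<B> N \<longleftrightarrow> nested_SQS v Q \<B> N \<and>
     (\<forall>P P'. ND_pair \<B> N P \<longrightarrow> ND_pair \<B> N P' \<longrightarrow>
        pair_multiplicity \<B> N P = pair_multiplicity \<B> N P')"

end

theory Submission imports Defs begin

text \<open>
  Let \<open>m\<close> be the common multiplicity and \<open>b\<close> the number of blocks. Counting the pairs of a triple
  and a block containing it gives \<open>4 b = (v choose 3)\<close>; counting the pairs of a 2-subset and a block
  whose partition contains it gives \<open>2 b = m (v choose 2)\<close>. As \<open>3 (v choose 3) = (v - 2) (v choose 2)\<close>,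
  eliminating \<open>b\<close> yields \<open>v - 2 = 6 m\<close>.
\<close>

text \<open>Both sides equal \<open>n * ((n - 1) choose 2)\<close>. Truncated subtraction does no
  harm: for \<open>n < 2\<close> both sides are 0.\<close>

lemma three_times_choose_three: "3 * (n choose 3) = (n - 2) * (n choose 2)"
  using binomial_absorption[of 2 n] binomial_absorb_comp[of n 2] by simp

lemma SQS_finite:
  assumes "SQS v Q \<B>"
  shows "finite Q" and "finite \<B>"
proof -
  show "finite Q"
    using assms by (auto simp: SQS_def intro: card_ge_0_finite)
  then show "finite \<B>"
    using assms finite_imp_finite_nsets finite_subset by (fastforce simp: SQS_def)
qed

lemma SQS_block:
  assumes "SQS v Q \<B>" and "B \<in> \<B>"
  shows "B \<subseteq> Q" and "card B = 4"
  using assms by (auto simp: SQS_def nsets_def)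

lemma SQS_card_blocks:
  assumes "SQS v Q \<B>"
  shows "4 * card \<B> = v choose 3"
proof -
  \<comment> \<open>The value 4 is \<open>4 choose 3\<close>.\<close>
  have "card {T \<in> nsets Q 3. T \<subseteq> B} = 4" if "B \<in> \<B>" for B
  proof -
    have "{T \<in> nsets Q 3. T \<subseteq> B} = nsets B 3"
      using SQS_block(1)[OF assms that] by (auto simp: nsets_def)
    then show ?thesis
      using SQS_block(2)[OF assms that] by (simp add: card_nsets numeral_eq_Suc)
  qed
  moreover have "card {B \<in> \<B>. T \<subseteq> B} = 1" if "T \<in> nsets Q 3" for T
  proof -
    have "\<exists>!B. B \<in> {B \<in> \<B>. T \<subseteq> B}"
      using assms that by (simp add: SQS_def)
    then show ?thesis
      by (simp only: card_1_singleton_iff One_nat_def) blast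
  qed
  ultimately show ?thesis
    using sum_multicount[of \<B> "nsets Q 3" "\<lambda>B T. T \<subseteq> B" 1] SQS_finite[OF assms] assms
    by (simp add: finite_imp_finite_nsets card_nsets SQS_def)
qed

lemma nested_SQS_card_blocks:
  assumes "nested_SQS v Q \<B> N" and "\<forall>P \<in> nsets Q 2. pair_multiplicity \<B> N P = m"
  shows "2 * card \<B> = m * (v choose 2)"
proof -
  have sqs: "SQS v Q \<B>"
    using assms(1) by (simp add: nested_SQS_def)
  have "card {P \<in> nsets Q 2. P \<in> N B} = 2" if "B \<in> \<B>" for B
  proof -
    \<comment> \<open>Since B lies in Q, restricting the count to pairs of Q loses no member of
      \<open>N B\<close>.\<close>
    have "N B \<subseteq> nsets Q 2"
      using assms(1) that nsets_mono[OF SQS_block(1)[OF sqs that]]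
      by (fastforce simp: nested_SQS_def)
    then have "{P \<in> nsets Q 2. P \<in> N B} = N B"
      by blast
    then show ?thesis
      using assms(1) that by (simp add: nested_SQS_def)
  qed
  then show ?thesis
    using sum_multicount[of \<B> "nsets Q 2" "\<lambda>B P. P \<in> N B" m] SQS_finite[OF sqs] assms(2) sqs
    by (simp add: finite_imp_finite_nsets card_nsets SQS_def pair_multiplicity_def)
qed

theorem theorem4p1:
  fixes v :: nat and Q :: "'a set" and \<B> :: "'a set set" and N :: "'a set \<Rightarrow> 'a set set"
  assumes "0 < v"
    and "uniform_nested_SQS v Q \<B> N"
    and "\<forall>P \<in> nsets Q 2. ND_pair \<B> N P"
  shows "[v = 2] (mod 6) \<and>
    (\<forall>P \<in> nsets Q 2. real (pair_multiplicity \<B> N P) = (real v - 2) / 6)"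
proof -
  have nested: "nested_SQS v Q \<B> N"
    using assms(2) by (simp add: uniform_nested_SQS_def)
  then have sqs: "SQS v Q \<B>" and "4 \<le> v"
    by (simp_all add: nested_SQS_def SQS_def)
  \<comment> \<open>Uniformity compares ND-pairs only; as every pair of Q is one, the multiplicity
    is constant on \<open>nsets Q 2\<close>.\<close>
  obtain m where m: "\<forall>P \<in> nsets Q 2. pair_multiplicity \<B> N P = m"
    using assms(2,3) unfolding uniform_nested_SQS_def by metis
  \<comment> \<open>Both sides equal \<open>12 * card \<B>\<close>.\<close>
  have "(v - 2) * (v choose 2) = 6 * m * (v choose 2)"
    using three_times_choose_three[of v] SQS_card_blocks[OF sqs] nested_SQS_card_blocks[OF nested m]
    by linarith
  moreover have "v choose 2 \<noteq> 0"
    using \<open>4 \<le> v\<close> by simp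
  ultimately have "v - 2 = 6 * m"
    by simp
  \<comment> \<open>The bound on v rules out truncation in \<open>v - 2\<close>.\<close>
  then have v: "v = 6 * m + 2"
    using \<open>4 \<le> v\<close> by linarith
  moreover have "[v = 2] (mod 6)"
    unfolding cong_def v by presburger
  ultimately show ?thesis
    using m by simp
qed

end
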